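(* Let $n\ge 0$ and $0\le k\le n$. Then $B_{n,k}$ equals each of the following: (1) the number of matchings on $2(n+1)$ points that avoid both patterns $123$ and $213$ and have exactly $k$ nestings; (2) the number of matchings on $2(n+1)$ points that avoid both patterns $231$ and $321$ and have exactly $k$ crossings.
   Context: A matching on $\{1,\dots,2m\}$ is a partition into $m$ pairs (arcs) $(i,j)$ with $i<j$. Two arcs $(i,j),(k,\ell)$ form a crossing if $i<k<j<\ell$ and a nesting if $i<k<\ell<j$; the number of crossings (nestings) of a matching is the number of unordered pairs of arcs forming a crossing (nesting). A matching $M$ avoids a pattern $\sigma\in\mathfrak S_r$ if there are no $2r$ points $i_1<i_2<\cdots<i_{2r}$ such that $M$ contains all the pairs $(i_s,i_{2r+1-\sigma(s)})$ for $1\le s\le r$. Catalan's triangle: $C_{n,s}=\frac{n-s+1}{n+1}\binom{n+s}{n}$; Borel's triangle: $B_{n,k}=\sum_{s=k}^{n}\binom{s}{k}C_{n,s}$. *)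

theory Defs
  imports Complex_Main "HOL-Library.Disjoint_Sets"
begin

definition is_matching :: "nat \<Rightarrow> nat set set \<Rightarrow> bool" where
  "is_matching m M \<longleftrightarrow> partition_on {1..2 * m} M \<and> (\<forall>A\<in>M. card A = 2)"

definition arcs :: "nat set set \<Rightarrow> (nat \<times> nat) set" where
  "arcs M = {(i, j). i < j \<and> {i, j} \<in> M}"

fun crossing :: "nat \<times> nat \<Rightarrow> nat \<times> nat \<Rightarrow> bool" where
  "crossing (i, j) (k, l) \<longleftrightarrow> i < k \<and> k < j \<and> j < l"

fun nesting :: "nat \<times> nat \<Rightarrow> nat \<times> nat \<Rightarrow> bool" where
  "nesting (i, j) (k, l) \<longleftrightarrow> i < k \<and> k < l \<and> l < j"

definition num_crossings :: "nat set set \<Rightarrow> nat" where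
  "num_crossings M = card {{a, b} | a b. a \<in> arcs M \<and> b \<in> arcs M \<and> crossing a b}"

definition num_nestings :: "nat set set \<Rightarrow> nat" where
  "num_nestings M = card {{a, b} | a b. a \<in> arcs M \<and> b \<in> arcs M \<and> nesting a b}"

text \<open>
  A pattern \<open>\<sigma>\<close> in the symmetric group on \<open>{1..r}\<close> is given in one-line notation, as the list
  \<open>[\<sigma>(1), \<dots>, \<sigma>(r)]\<close>; lists are indexed from 0, so \<open>\<sigma>(s)\<close> is \<open>\<sigma> ! (s - 1)\<close>. The natural-number
  subtraction \<open>2 * r + 1 - \<sigma>(s)\<close> does not truncate, since \<open>\<sigma>(s) \<le> r\<close>.
\<close>

definition avoids :: "nat set set \<Rightarrow> nat list \<Rightarrow> bool" where
  "avoids M \<sigma> \<longleftrightarrow>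
    (let r = length \<sigma> in
      \<not> (\<exists>i :: nat \<Rightarrow> nat. strict_mono_on {1..2 * r} i \<and>
            (\<forall>s\<in>{1..r}. (i s, i (2 * r + 1 - \<sigma> ! (s - 1))) \<in> arcs M)))"

definition catalan_triangle :: "nat \<Rightarrow> nat \<Rightarrow> rat" where
  "catalan_triangle n s =
    (of_nat n - of_nat s + 1) / (of_nat n + 1) * of_nat ((n + s) choose n)"

definition borel_triangle :: "nat \<Rightarrow> nat \<Rightarrow> rat" where
  "borel_triangle n k = (\<Sum>s = k..n. of_nat (s choose k) * catalan_triangle n s)"

end

theory Submission
  imports Defs
begin

text \<open>
  Build a matching from right to left: each point is either declared a closer, or it is an opener
  \<open>k\<close> and picks its partner \<open>l\<close> among the closers still available. The arcs crossing \<open>(k, l)\<close> from the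
  left correspond to the available closers smaller than \<open>l\<close>, the arcs nesting \<open>(k, l)\<close> to those
  greater than \<open>l\<close>; the two pairs of patterns say that this number is at most 1 for every arc. Hence
  both statistics are counted by Dyck paths in which each down step from height at least 2 has
  weight \<open>1 + q\<close>. The Dyck paths of semilength \<open>n + 1\<close> having \<open>s\<close> such steps are those with \<open>n + 1 - s\<close>
  returns to the axis, and their number is \<open>C\<^bsub>n,s\<^esub>\<close>.
\<close>

section \<open>Weighted Dyck paths\<close>

text \<open>
  The number of paths with \<open>N\<close> steps from height \<open>h\<close> to \<open>0\<close>, in which \<open>s\<close> down steps start at
  height at least 2.
\<close>

fun high_paths :: "nat \<Rightarrow> nat \<Rightarrow> nat \<Rightarrow> nat" where
  "high_paths 0 h s = (if h = 0 \<and> s = 0 then 1 else 0)"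
| "high_paths (Suc N) h s = high_paths N (Suc h) s
     + (if h = 1 then high_paths N 0 s else 0)
     + (if 2 \<le> h \<and> 1 \<le> s then high_paths N (h - 1) (s - 1) else 0)"

text \<open>As above, but \<open>k\<close> of the down steps starting at height at least 2 are marked.\<close>

fun marked_paths :: "nat \<Rightarrow> nat \<Rightarrow> nat \<Rightarrow> nat" where
  "marked_paths 0 h k = (if h = 0 \<and> k = 0 then 1 else 0)"
| "marked_paths (Suc N) h k = marked_paths N (Suc h) k
     + (if 1 \<le> h then marked_paths N (h - 1) k else 0)
     + (if 2 \<le> h \<and> 1 \<le> k then marked_paths N (h - 1) (k - 1) else 0)"

lemma high_paths_eq_0: "N < s \<Longrightarrow> high_paths N h s = 0"
  by (induction N arbitrary: h s) auto

text \<open>Marking picks \<open>k\<close> of the \<open>s\<close> high down steps, whence the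
  factor \<open>s choose k\<close>; in the induction Pascal's rule decides whether a first step down
  is marked.\<close>

lemma marked_paths_eq_sum:
  "marked_paths N h k = (\<Sum>s\<le>N. (s choose k) * high_paths N h s)"
proof (induction N arbitrary: h k)
  case 0
  show ?case by simp
next
  case (Suc N)
  \<comment> \<open>The added term \<open>s = Suc N\<close> vanishes, since \<open>N\<close> steps
    cannot contain \<open>Suc N\<close> high down steps.\<close>
  have ext: "(\<Sum>s\<le>Suc N. (s choose k) * high_paths N h s) = marked_paths N h k" for h k
    using Suc.IH[of h k] by (simp add: high_paths_eq_0)
  \<comment> \<open>A first step down from height at least 2 raises \<open>s\<close> by one;
    Pascal's rule for \<open>Suc s choose k\<close> separates the unmarked from the marked
    case.\<close>
  have shift: "(\<Sum>s\<le>Suc N. (s choose k) * (if 1 \<le> s then high_paths N h (s - 1) else 0))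
      = marked_paths N h k + (if 1 \<le> k then marked_paths N h (k - 1) else 0)" for h k
  proof -
    have "(\<Sum>s\<le>Suc N. (s choose k) * (if 1 \<le> s then high_paths N h (s - 1) else 0))
        = (\<Sum>s\<le>N. (Suc s choose k) * high_paths N h s)"
      by (subst sum.atMost_Suc_shift) simp
    also have "\<dots> = marked_paths N h k + (if 1 \<le> k then marked_paths N h (k - 1) else 0)"
      by (cases k) (simp_all add: Suc.IH algebra_simps sum.distrib)
    finally show ?thesis .
  qed
  consider "h = 0" | "h = 1" | "2 \<le> h" by linarith
  then show ?case
  proof cases
    case 1
    then show ?thesis using ext[of k "Suc 0"] by simp
  next
    case 2
    then show ?thesis using ext[of k 2] ext[of k 0]
      by (simp add: algebra_simps sum.distrib numeral_2_eq_2)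
  next
    case 3
    have "(\<Sum>s\<le>Suc N. (s choose k) * high_paths (Suc N) h s) =
        (\<Sum>s\<le>Suc N. (s choose k) * high_paths N (Suc h) s)
        + (\<Sum>s\<le>Suc N. (s choose k) * (if 1 \<le> s then high_paths N (h - 1) (s - 1) else 0))"
      unfolding sum.distrib[symmetric]
      by (rule sum.cong) (use 3 in \<open>auto simp: algebra_simps\<close>)
    then show ?thesis
      unfolding ext shift using 3 by simp
  qed
qed

section \<open>Catalan's triangle and the count of paths by high down steps\<close>

lemma catalan_triangle_0 [simp]: "catalan_triangle n 0 = 1"
  by (simp add: catalan_triangle_def)

lemma catalan_triangle_Suc_self [simp]: "catalan_triangle n (Suc n) = 0"
  by (simp add: catalan_triangle_def)

text \<open>The binomials \<open>b\<close> and \<open>c\<close> are proportional by absorption, so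
  after clearing denominators the rule is a linear identity in them. Subtraction is rational, so
  \<open>s > n\<close> is covered as well.\<close>

lemma catalan_triangle_rec:
  "catalan_triangle (Suc n) (Suc s) = catalan_triangle (Suc n) s + catalan_triangle n (Suc s)"
proof -
  define b where "b = (of_nat ((n + s + 1) choose n) :: rat)"
  define c where "c = (of_nat ((n + s + 1) choose Suc n) :: rat)"
  have "Suc s * ((n + s + 1) choose n) = Suc n * ((n + s + 1) choose Suc n)"
    using Suc_times_binomial_add[of n s] by (simp add: algebra_simps)
  then have "of_nat (Suc s * ((n + s + 1) choose n)) =
      (of_nat (Suc n * ((n + s + 1) choose Suc n)) :: rat)"
    by (rule arg_cong)
  then have bc: "(of_nat s + 1) * b = (of_nat n + 1) * c"
    by (simp add: b_def c_def algebra_simps del: binomial_Suc_Suc)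
  have "(of_nat ((Suc n + Suc s) choose Suc n) :: rat) = b + c"
    by (simp add: b_def c_def)
  then have "catalan_triangle (Suc n) (Suc s) = (of_nat n - of_nat s + 1) / (of_nat n + 2) * (b + c)"
    by (simp add: catalan_triangle_def add.commute)
  moreover have "catalan_triangle (Suc n) s = (of_nat n - of_nat s + 2) / (of_nat n + 2) * c"
    by (simp add: catalan_triangle_def c_def algebra_simps)
  moreover have "catalan_triangle n (Suc s) = (of_nat n - of_nat s) / (of_nat n + 1) * b"
    by (simp add: catalan_triangle_def b_def algebra_simps)
  moreover have "(x - y + 1) / (x + 2) * (b + c) = (x - y + 2) / (x + 2) * c + (x - y) / (x + 1) * b"
    if "x + 1 \<noteq> 0" "x + 2 \<noteq> 0" "(y + 1) * b = (x + 1) * c" for x y :: rat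
  proof -
    \<comment> \<open>The two sides differ by \<open>(y + 1) * b - (x + 1) * c\<close>.\<close>
    have "(x - y + 1) * (b + c) * (x + 1) = (x - y + 2) * c * (x + 1) + (x - y) * b * (x + 2)"
      using that(3) by algebra
    moreover have "(x - y + 1) / (x + 2) * (b + c) =
        (x - y + 1) * (b + c) * (x + 1) / ((x + 2) * (x + 1))"
      using that(1) by simp
    moreover have "(x - y + 2) / (x + 2) * c + (x - y) / (x + 1) * b =
        ((x - y + 2) * c * (x + 1) + (x - y) * b * (x + 2)) / ((x + 2) * (x + 1))"
      using that(1,2) by (simp add: add_frac_eq mult.commute)
    ultimately show ?thesis by simp
  qed
  moreover have "of_nat n + 1 \<noteq> (0 :: rat)" "of_nat n + 2 \<noteq> (0 :: rat)"
    by (simp_all add: add_nonneg_eq_0_iff)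
  ultimately show ?thesis
    using bc by simp
qed

text \<open>
  The truncated \<open>h - 1\<close> also covers \<open>h = 0\<close>: there the first step is up, and height \<open>1\<close> gives the
  same value.
\<close>

lemma high_paths_eq_catalan_triangle:
  "\<lbrakk>N + h = 2 * D; 0 < D\<rbrakk> \<Longrightarrow> of_nat (high_paths N h s) =
     (if h \<le> s + 1 \<and> s < D then catalan_triangle (D - 1) (s - (h - 1)) else 0)"
proof (induction N arbitrary: h D s)
  case 0
  \<comment> \<open>Here \<open>h = 2 * D\<close>, so \<open>h \<le> s + 1\<close> and
    \<open>s < D\<close> would give \<open>2 * D \<le> D\<close>; both sides are 0.\<close>
  then show ?case by auto
next
  case (Suc N)
  obtain n where D: "D = Suc n" using Suc.prems(2) gr0_implies_Suc by blast
  consider "h = 0" | "h = 1" | "2 \<le> h" by linarith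
  then show ?case
  proof cases
    case 1
    then have "high_paths (Suc N) h s = high_paths N 1 s" by simp
    then show ?thesis
      using Suc.IH[of 1 D s] Suc.prems 1 by (simp del: high_paths.simps)
  next
    case 2
    \<comment> \<open>A step down from height 1 leaves a path of semilength \<open>n\<close>. The
      induction hypothesis needs \<open>0 < n\<close>; for \<open>n = 0\<close> only the empty path
      remains.\<close>
    have low: "of_nat (high_paths N 0 s) =
      (if s < n then catalan_triangle (n - 1) s else if n = 0 \<and> s = 0 then 1 else 0)"
      using Suc.IH[of 0 n s] Suc.prems 2 D by (cases "n = 0") auto
    have high: "of_nat (high_paths N 2 s) =
      (if 1 \<le> s \<and> s < D then catalan_triangle n (s - 1) else 0)"
      using Suc.IH[of 2 D s] Suc.prems 2 D by auto
    show ?thesis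
    proof (cases s)
      case 0
      then show ?thesis using low high 2 D by (auto simp: numeral_2_eq_2)
    next
      case (Suc t)
      show ?thesis
      proof (cases n)
        case 0
        then show ?thesis using Suc low high 2 D by (auto simp: numeral_2_eq_2)
      next
        case (Suc m)
        \<comment> \<open>At \<open>s = n\<close> the count \<open>low\<close> is 0, in agreement
          with \<open>catalan_triangle m (Suc m) = 0\<close>.\<close>
        then show ?thesis using \<open>s = Suc t\<close> low high 2 D catalan_triangle_rec[of m t]
          by (auto simp: numeral_2_eq_2 less_Suc_eq)
      qed
    qed
  next
    case 3
    then obtain g where g: "h = Suc (Suc g)" by (metis add_2_eq_Suc le_Suc_ex)
    have up: "of_nat (high_paths N (Suc h) s) =
      (if h \<le> s \<and> s < D then catalan_triangle n (s - h) else 0)"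
      using Suc.IH[of "Suc h" D s] Suc.prems D by auto
    have down: "of_nat (high_paths N (h - 1) (s - 1)) =
      (if h - 1 \<le> s \<and> s < D then catalan_triangle (n - 1) (s - 1 - g) else 0)" if "1 \<le> s"
      using Suc.IH[of "h - 1" n "s - 1"] Suc.prems D g that by auto
    \<comment> \<open>A descent from \<open>h\<close> to 0 takes at least \<open>h - 1\<close> high
      down steps. If \<open>s\<close> is exactly that number, only a first step down survives and,
      for \<open>s < D\<close>, both sides are an entry with index 0, that is 1. Beyond that the
      Catalan recurrence applies.\<close>
    consider "s + 1 < h" | "h = s + 1" | "h \<le> s" by linarith
    then show ?thesis
    proof cases
      case 1
      then show ?thesis using up down 3 by (cases s) auto
    next
      case 2
      then show ?thesis using up down 3 g by auto
    next
      case 3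
      show ?thesis
      proof (cases "s < D")
        case True
        then obtain m where m: "n = Suc m" using 3 g D by (cases n) auto
        have "s - (h - 1) = Suc (s - h)" "s - 1 - g = Suc (s - h)" using 3 g by auto
        then show ?thesis
          using catalan_triangle_rec[of m "s - h"] up down True 3 g D m by simp
      next
        case False
        then show ?thesis using up down 3 g by simp
      qed
    qed
  qed
qed

lemma borel_triangle_eq_marked_paths:
  "borel_triangle n k = of_nat (marked_paths (2 * (n + 1)) 0 k)"
proof -
  have "of_nat (marked_paths (2 * (n + 1)) 0 k)
      = (\<Sum>s\<le>2 * (n + 1). of_nat (s choose k) * (of_nat (high_paths (2 * (n + 1)) 0 s) :: rat))"
    by (simp only: marked_paths_eq_sum of_nat_sum of_nat_mult)
  also have "\<dots> = (\<Sum>s\<le>2 * (n + 1). of_nat (s choose k) * (if s < n + 1 then catalan_triangle n s else 0))"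
    by (intro sum.cong refl, subst high_paths_eq_catalan_triangle[of _ _ "n + 1"]) auto
  also have "\<dots> = (\<Sum>s = k..n. of_nat (s choose k) * catalan_triangle n s)"
    \<comment> \<open>Terms with \<open>s < k\<close> vanish through the binomial, those with
      \<open>s > n\<close> through the conditional.\<close>
    by (rule sum.mono_neutral_cong_right) (auto simp: not_le)
  finally show ?thesis
    by (simp add: borel_triangle_def)
qed

section \<open>Arc diagrams\<close>

text \<open>A perfect matching of \<open>X\<close>, kept as ordered arcs. Allowing any point set,
  not just an initial interval, lets arcs be deleted without relabelling.\<close>

definition arc_diagram :: "nat set \<Rightarrow> (nat \<times> nat) set \<Rightarrow> bool" where
  "arc_diagram X A \<longleftrightarrow> (\<forall>a\<in>A. fst a < snd a \<and> fst a \<in> X \<and> snd a \<in> X) \<and>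
     (\<forall>x\<in>X. \<exists>!a. a \<in> A \<and> (x = fst a \<or> x = snd a))"

text \<open>
  For \<open>R\<close> being \<open><\<close> this is the number of arcs crossing \<open>a\<close> from the left, for \<open>>\<close> the number of
  arcs nesting \<open>a\<close>.
\<close>

definition left_degree :: "(nat \<Rightarrow> nat \<Rightarrow> bool) \<Rightarrow> (nat \<times> nat) set \<Rightarrow> nat \<times> nat \<Rightarrow> nat" where
  "left_degree R A a = card {b \<in> A. fst b < fst a \<and> fst a < snd b \<and> R (snd b) (snd a)}"

text \<open>\<open>C\<close> is the set of closers whose openers lie in \<open>{1..N}\<close>.\<close>

definition thin_diagrams ::
  "(nat \<Rightarrow> nat \<Rightarrow> bool) \<Rightarrow> nat \<Rightarrow> nat set \<Rightarrow> nat \<Rightarrow> (nat \<times> nat) set set" where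
  "thin_diagrams R N C k = {A. arc_diagram ({1..N} \<union> C) A \<and> (\<forall>a\<in>A. fst a \<le> N) \<and>
     (\<forall>a\<in>A. left_degree R A a \<le> 1) \<and> (\<Sum>a\<in>A. left_degree R A a) = k}"

lemma arc_diagram_memD:
  assumes "arc_diagram X A" "a \<in> A"
  shows "fst a < snd a" "fst a \<in> X" "snd a \<in> X"
  using assms unfolding arc_diagram_def by blast+

lemma arc_diagram_unique:
  assumes "arc_diagram X A" "a \<in> A" "b \<in> A" "x = fst a \<or> x = snd a" "x = fst b \<or> x = snd b"
  shows "a = b"
proof -
  have "x \<in> X" using arc_diagram_memD[OF assms(1,2)] assms(4) by auto
  then show ?thesis using assms unfolding arc_diagram_def by blast
qed

lemma arc_diagram_covers:
  assumes "arc_diagram X A" "x \<in> X"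
  obtains a where "a \<in> A" "x = fst a \<or> x = snd a"
  using assms unfolding arc_diagram_def by blast

lemma arc_diagram_subset: "arc_diagram X A \<Longrightarrow> A \<subseteq> X \<times> X"
  using arc_diagram_memD by (auto simp: mem_Times_iff)

lemma finite_arc_diagram: "\<lbrakk>arc_diagram X A; finite X\<rbrakk> \<Longrightarrow> finite A"
  by (rule finite_subset[OF arc_diagram_subset]) auto

lemma arc_diagram_empty: "arc_diagram {} A \<longleftrightarrow> A = {}"
  unfolding arc_diagram_def by blast

text \<open>Demanding \<open>(x, y) \<notin> A\<close> makes this an equivalence, usable both for
  adding and for deleting an arc.\<close>

lemma arc_diagram_insert:
  assumes "x < y" "x \<notin> X" "y \<notin> X"
  shows "arc_diagram (insert x (insert y X)) (insert (x, y) A) \<and> (x, y) \<notin> A \<longleftrightarrow> arc_diagram X A"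
proof
  assume *: "arc_diagram (insert x (insert y X)) (insert (x, y) A) \<and> (x, y) \<notin> A"
  then have d: "arc_diagram (insert x (insert y X)) (insert (x, y) A)" by simp
  have mem: "fst a \<in> X \<and> snd a \<in> X \<and> fst a < snd a" if "a \<in> A" for a
  proof -
    have "a \<noteq> (x, y)" using * that by auto
    then have "fst a \<noteq> x" "fst a \<noteq> y" "snd a \<noteq> x" "snd a \<noteq> y"
      using arc_diagram_unique[OF d, of a "(x, y)"] that by auto
    moreover have "fst a < snd a \<and> fst a \<in> insert x (insert y X) \<and> snd a \<in> insert x (insert y X)"
      using arc_diagram_memD[OF d, of a] that by blast
    ultimately show ?thesis by auto
  qed
  have "\<exists>!a. a \<in> A \<and> (z = fst a \<or> z = snd a)" if z: "z \<in> X" for z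
  proof -
    obtain a where a: "a \<in> insert (x, y) A" "z = fst a \<or> z = snd a"
      using arc_diagram_covers[OF d] z by blast
    moreover have "a \<noteq> (x, y)" using a(2) z assms by auto
    ultimately have "a \<in> A" by simp
    then show ?thesis
      by (intro ex1I[of _ a]) (use a arc_diagram_unique[OF d, of _ a z] in auto)
  qed
  then show "arc_diagram X A" using mem unfolding arc_diagram_def by blast
next
  assume d: "arc_diagram X A"
  have notin: "fst a \<noteq> x \<and> fst a \<noteq> y \<and> snd a \<noteq> x \<and> snd a \<noteq> y" if "a \<in> A" for a
    using arc_diagram_memD[OF d, of a] that assms by auto
  have ex1: "\<forall>z\<in>insert x (insert y X). \<exists>!a. a \<in> insert (x, y) A \<and> (z = fst a \<or> z = snd a)"
  proof
    fix z assume z: "z \<in> insert x (insert y X)"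
    show "\<exists>!a. a \<in> insert (x, y) A \<and> (z = fst a \<or> z = snd a)"
    proof (cases "z \<in> X")
      case True
      then obtain a where a: "a \<in> A" "z = fst a \<or> z = snd a"
        using arc_diagram_covers[OF d] by blast
      have "z \<noteq> x" "z \<noteq> y" using True assms by auto
      then have "b = a" if "b \<in> insert (x, y) A" "z = fst b \<or> z = snd b" for b
        using arc_diagram_unique[OF d, of b a z] a that by auto
      then show ?thesis using a by blast
    next
      case False
      then have "z = x \<or> z = y" using z by auto
      then show ?thesis
        by (intro ex1I[of _ "(x, y)"]) (use notin in auto)
    qed
  qed
  have mem: "\<forall>a\<in>insert (x, y) A. fst a < snd a \<and> fst a \<in> insert x (insert y X) \<and>
      snd a \<in> insert x (insert y X)"
    using assms(1) arc_diagram_memD[OF d] by auto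
  have new: "(x, y) \<notin> A" using notin[of "(x, y)"] by auto
  show "arc_diagram (insert x (insert y X)) (insert (x, y) A) \<and> (x, y) \<notin> A"
    unfolding arc_diagram_def by (intro conjI ex1 mem new)
qed

text \<open>Crossings and nestings differ only in the direction in which closers are compared; an
  abstract order treats both at once.\<close>

locale strict_total_order =
  fixes R :: "nat \<Rightarrow> nat \<Rightarrow> bool"
  assumes irrefl: "\<not> R x x"
    and trans: "R x y \<Longrightarrow> R y z \<Longrightarrow> R x z"
    and total: "x \<noteq> y \<Longrightarrow> R x y \<or> R y x"
begin

text \<open>The rank strictly increases along \<open>R\<close>, hence is injective, and it stays
  below \<open>card C\<close>; equal cardinalities give surjectivity.\<close>

lemma bij_betw_rank:
  assumes "finite C"
  shows "bij_betw (\<lambda>c. card {c' \<in> C. R c' c}) C {..<card C}"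
proof -
  let ?d = "\<lambda>c. card {c' \<in> C. R c' c}"
  have less: "?d a < ?d b" if "a \<in> C" "R a b" for a b
  proof (rule psubset_card_mono)
    have "{c' \<in> C. R c' a} \<subseteq> {c' \<in> C. R c' b}" using trans[OF _ that(2)] by blast
    moreover have "a \<in> {c' \<in> C. R c' b}" "a \<notin> {c' \<in> C. R c' a}" using that irrefl by auto
    ultimately show "{c' \<in> C. R c' a} \<subset> {c' \<in> C. R c' b}" by blast
  qed (use assms in auto)
  have inj: "inj_on ?d C"
  proof (rule inj_onI, rule ccontr)
    fix a b assume "a \<in> C" "b \<in> C" "?d a = ?d b" "a \<noteq> b"
    then show False using less[of a b] less[of b a] total[of a b] by auto
  qed
  have "?d c < card C" if "c \<in> C" for c
  proof (rule psubset_card_mono)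
    show "{c' \<in> C. R c' c} \<subset> C" using that irrefl[of c] by blast
  qed (rule assms)
  then have "?d ` C = {..<card C}"
    by (intro card_subset_eq) (auto simp: card_image[OF inj])
  then show ?thesis using inj by (simp add: bij_betw_def)
qed

text \<open>Every closer in \<open>C\<close> other than \<open>c\<close> ends an arc opened at
  \<open>N\<close> or earlier, which therefore passes over \<open>Suc N\<close>. So the degree of
  the new arc depends only on the rank of \<open>c\<close>, not on \<open>A\<close>.\<close>

lemma left_degree_insert_last:
  assumes "arc_diagram ({1..N} \<union> (C - {c})) A" "\<forall>a\<in>A. fst a \<le> N" "\<forall>x\<in>C. Suc N < x"
  shows "left_degree R (insert (Suc N, c) A) (Suc N, c) = card {c' \<in> C. R c' c}"
proof -
  let ?B = "{b \<in> insert (Suc N, c) A. fst b < Suc N \<and> Suc N < snd b \<and> R (snd b) c}"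
  have "bij_betw snd ?B {c' \<in> C. R c' c}"
    unfolding bij_betw_def
  proof
    show "inj_on snd ?B"
    proof (rule inj_onI)
      fix a b assume "a \<in> ?B" "b \<in> ?B" "snd a = snd b"
      then show "a = b" using arc_diagram_unique[OF assms(1), of a b "snd a"] by auto
    qed
    show "snd ` ?B = {c' \<in> C. R c' c}"
    proof (intro equalityI subsetI)
      fix x assume "x \<in> snd ` ?B"
      then obtain b where b: "b \<in> A" "Suc N < snd b" "R (snd b) c" "x = snd b" by auto
      then show "x \<in> {c' \<in> C. R c' c}"
        using arc_diagram_memD[OF assms(1) b(1)] by auto
    next
      fix x assume x: "x \<in> {c' \<in> C. R c' c}"
      then have "x \<noteq> c" using irrefl by auto
      then obtain a where a: "a \<in> A" "x = fst a \<or> x = snd a"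
        using arc_diagram_covers[OF assms(1), of x] x by auto
      moreover have "Suc N < x" using x assms(3) by auto
      moreover have "fst a \<le> N" using a assms(2) by auto
      ultimately show "x \<in> snd ` ?B" using x by (intro image_eqI[of _ _ a]) auto
    qed
  qed
  then show ?thesis
    unfolding left_degree_def by (simp add: bij_betw_same_card)
qed

text \<open>The new arc opens last, while only arcs opening before \<open>a\<close> contribute to
  its left degree.\<close>

lemma left_degree_insert_right:
  "fst a \<le> N \<Longrightarrow> left_degree R (insert (Suc N, c) A) a = left_degree R A a"
  unfolding left_degree_def by (rule arg_cong[where f = card]) auto

text \<open>Deleting the arc that opens last lowers the total by the rank of \<open>c\<close> and
  leaves all other degrees unchanged. The bound 1 on the rank is thinness; the bound
  \<open>k\<close> keeps the subtraction from \<open>k\<close> exact.\<close>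

lemma thin_diagrams_opener:
  assumes "finite C" "c \<in> C" "\<forall>x\<in>C. Suc N < x"
  shows "{A \<in> thin_diagrams R (Suc N) C k. (Suc N, c) \<in> A} =
    insert (Suc N, c) ` (if card {c' \<in> C. R c' c} \<le> min 1 k
      then thin_diagrams R N (C - {c}) (k - card {c' \<in> C. R c' c}) else {})"
    (is "?L = insert ?a ` (if ?d \<le> min 1 k then ?T else {})")
proof -
  have X: "{1..Suc N} \<union> C = insert (Suc N) (insert c ({1..N} \<union> (C - {c})))"
    using assms by auto
  have fresh: "Suc N < c" "Suc N \<notin> {1..N} \<union> (C - {c})" "c \<notin> {1..N} \<union> (C - {c})"
    using assms by auto
  note ins = arc_diagram_insert[OF fresh, folded X]
  have fin: "finite ({1..N} \<union> (C - {c}))" using assms by auto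
  have *: "insert ?a A \<in> thin_diagrams R (Suc N) C k \<longleftrightarrow> ?d \<le> min 1 k \<and> A \<in> ?T"
    if d: "arc_diagram ({1..N} \<union> (C - {c})) A" and le: "\<forall>a\<in>A. fst a \<le> N" for A
  proof -
    have a: "?a \<notin> A" using le by auto
    have dA: "arc_diagram ({1..Suc N} \<union> C) (insert ?a A)" using d ins by blast
    have last: "left_degree R (insert ?a A) ?a = ?d"
      by (rule left_degree_insert_last[OF d le assms(3)])
    have right: "left_degree R (insert ?a A) a = left_degree R A a" if "a \<in> A" for a
      by (rule left_degree_insert_right) (use le that in auto)
    have "(\<Sum>a\<in>insert ?a A. left_degree R (insert ?a A) a) = ?d + (\<Sum>a\<in>A. left_degree R A a)"
      using a finite_arc_diagram[OF d fin] by (simp add: last right)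
    moreover have "(\<forall>a\<in>insert ?a A. fst a \<le> Suc N)" using le by auto
    ultimately show ?thesis
      using d dA le by (auto simp: thin_diagrams_def last right)
  qed
  show ?thesis
  proof (intro equalityI subsetI)
    fix B assume B: "B \<in> ?L"
    define A where "A = B - {?a}"
    have BA: "B = insert ?a A" "?a \<notin> A" using B by (auto simp: A_def)
    have dB: "arc_diagram ({1..Suc N} \<union> C) B" using B by (auto simp: thin_diagrams_def)
    then have d: "arc_diagram ({1..N} \<union> (C - {c})) A" using ins BA by blast
    have "fst a \<le> N" if "a \<in> A" for a
    proof -
      have "fst a \<noteq> Suc N" using arc_diagram_memD[OF d, of a] that fresh by auto
      moreover have "fst a \<le> Suc N" using B BA that by (auto simp: thin_diagrams_def)
      ultimately show ?thesis by simp
    qed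
    then show "B \<in> insert ?a ` (if ?d \<le> min 1 k then ?T else {})"
      using *[OF d] B BA by auto
  next
    fix B assume "B \<in> insert ?a ` (if ?d \<le> min 1 k then ?T else {})"
    then obtain A where A: "B = insert ?a A" "?d \<le> min 1 k" "A \<in> ?T"
      by (auto split: if_splits)
    then have "insert ?a A \<in> thin_diagrams R (Suc N) C k"
      using * by (auto simp: thin_diagrams_def)
    then show "B \<in> ?L" using A by auto
  qed
qed

text \<open>The point \<open>Suc N\<close> is either an opener, whose partner must lie in
  \<open>C\<close>, or a closer, and then it joins the available ones.\<close>

lemma thin_diagrams_Suc:
  assumes "\<forall>x\<in>C. Suc N < x"
  shows "thin_diagrams R (Suc N) C k = thin_diagrams R N (insert (Suc N) C) k \<union>
    (\<Union>c\<in>C. {A \<in> thin_diagrams R (Suc N) C k. (Suc N, c) \<in> A})"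
proof -
  have X: "{1..Suc N} \<union> C = {1..N} \<union> insert (Suc N) C" by auto
  show ?thesis
  proof (intro equalityI subsetI)
    fix A assume A: "A \<in> thin_diagrams R (Suc N) C k"
    then have d: "arc_diagram ({1..Suc N} \<union> C) A" by (auto simp: thin_diagrams_def)
    show "A \<in> thin_diagrams R N (insert (Suc N) C) k \<union>
        (\<Union>c\<in>C. {A \<in> thin_diagrams R (Suc N) C k. (Suc N, c) \<in> A})"
    proof (cases "\<exists>c. (Suc N, c) \<in> A")
      case True
      then obtain c where c: "(Suc N, c) \<in> A" by blast
      then have "c \<in> C" using arc_diagram_memD[OF d c] by auto
      then show ?thesis using A c by auto
    next
      case False
      then have "fst a \<noteq> Suc N" if "a \<in> A" for a using that by (metis prod.collapse)
      then have "\<forall>a\<in>A. fst a \<le> N" using A by (auto simp: thin_diagrams_def le_Suc_eq)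
      then show ?thesis using A X by (auto simp: thin_diagrams_def)
    qed
  next
    fix A assume "A \<in> thin_diagrams R N (insert (Suc N) C) k \<union>
        (\<Union>c\<in>C. {A \<in> thin_diagrams R (Suc N) C k. (Suc N, c) \<in> A})"
    then show "A \<in> thin_diagrams R (Suc N) C k"
      using X by (auto simp: thin_diagrams_def le_Suc_eq)
  qed
qed

lemma finite_thin_diagrams:
  assumes "finite C"
  shows "finite (thin_diagrams R N C k)"
proof (rule finite_subset)
  show "thin_diagrams R N C k \<subseteq> Pow (({1..N} \<union> C) \<times> ({1..N} \<union> C))"
    unfolding thin_diagrams_def using arc_diagram_subset by blast
qed (use assms in simp)

text \<open>Reading points from right to left, \<open>card C\<close> is the height: a closer is a
  step up, an opener a step down. A partner of rank 0 gives an unmarked step, one of rank 1 a marked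
  step.\<close>

lemma card_thin_diagrams:
  "\<lbrakk>finite C; \<forall>c\<in>C. N < c\<rbrakk> \<Longrightarrow> card (thin_diagrams R N C k) = marked_paths N (card C) k"
proof (induction N arbitrary: C k)
  case 0
  have "thin_diagrams R 0 C k = (if C = {} \<and> k = 0 then {{}} else {})"
  proof (cases "C = {}")
    case True
    then have "A \<in> thin_diagrams R 0 C k \<longleftrightarrow> A = {} \<and> k = 0" for A
      by (auto simp: thin_diagrams_def arc_diagram_empty)
    then show ?thesis using True by auto
  next
    case False
    then obtain c where "c \<in> C" by blast
    \<comment> \<open>No point can be an opener, as all points of \<open>C\<close> exceed 0; so a
      nonempty \<open>C\<close> cannot be covered.\<close>
    have "False" if "A \<in> thin_diagrams R 0 C k" for A
    proof -
      have d: "arc_diagram C A" "\<forall>a\<in>A. fst a \<le> 0"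
        using that by (auto simp: thin_diagrams_def)
      obtain a where "a \<in> A" using arc_diagram_covers[OF d(1) \<open>c \<in> C\<close>] by blast
      then have "fst a \<in> C" "fst a = 0" using d arc_diagram_memD[OF d(1)] by auto
      then show False using 0 by auto
    qed
    then show ?thesis using False by auto
  qed
  then show ?case using 0 by (auto simp: card_gt_0_iff)
next
  case (Suc N)
  let ?d = "\<lambda>c. card {c' \<in> C. R c' c}"
  let ?O = "\<lambda>c. {A \<in> thin_diagrams R (Suc N) C k. (Suc N, c) \<in> A}"
  let ?F = "\<lambda>i. if i \<le> min 1 k then marked_paths N (card C - 1) (k - i) else 0"
  have card_O: "card (?O c) = ?F (?d c)" if c: "c \<in> C" for c
  proof -
    have "inj_on (insert (Suc N, c)) (thin_diagrams R N (C - {c}) (k - ?d c))"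
    proof (rule inj_onI)
      fix A B assume AB: "A \<in> thin_diagrams R N (C - {c}) (k - ?d c)"
        "B \<in> thin_diagrams R N (C - {c}) (k - ?d c)" "insert (Suc N, c) A = insert (Suc N, c) B"
      then have "(Suc N, c) \<notin> A" "(Suc N, c) \<notin> B" by (force simp: thin_diagrams_def)+
      with AB(3) show "A = B" by (metis insert_ident)
    qed
    moreover have "card (thin_diagrams R N (C - {c}) (k - ?d c)) = marked_paths N (card C - 1) (k - ?d c)"
      by (subst Suc.IH) (use Suc.prems c in auto)
    ultimately show ?thesis
      by (subst thin_diagrams_opener) (use Suc.prems c in \<open>auto simp: card_image\<close>)
  qed
  have closer: "(Suc N, c) \<notin> A" if "A \<in> thin_diagrams R N (insert (Suc N) C) k" for A c
    using that by (force simp: thin_diagrams_def)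
  \<comment> \<open>The point \<open>Suc N\<close> lies on one arc only, so the families for
    different partners are disjoint.\<close>
  have disj: "?O c \<inter> ?O c' = {}" if "c \<noteq> c'" for c c'
  proof -
    have "(Suc N, c') \<notin> A" if "A \<in> ?O c" for A
      using that arc_diagram_unique[of "{1..Suc N} \<union> C" A "(Suc N, c)" "(Suc N, c')" "Suc N"] \<open>c \<noteq> c'\<close>
      by (auto simp: thin_diagrams_def)
    then show ?thesis by blast
  qed
  have "card (thin_diagrams R (Suc N) C k) =
      card (thin_diagrams R N (insert (Suc N) C) k) + card (\<Union>c\<in>C. ?O c)"
    by (subst thin_diagrams_Suc[OF Suc.prems(2)], rule card_Un_disjoint)
      (use Suc.prems(1) closer finite_thin_diagrams in auto)
  also have "card (thin_diagrams R N (insert (Suc N) C) k) = marked_paths N (Suc (card C)) k"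
    by (subst Suc.IH) (use Suc.prems in auto)
  also have "card (\<Union>c\<in>C. ?O c) = (\<Sum>c\<in>C. card (?O c))"
    by (rule card_UN_disjoint) (use Suc.prems(1) finite_thin_diagrams disj in auto)
  also have "\<dots> = (\<Sum>c\<in>C. ?F (?d c))"
    using card_O by simp
  \<comment> \<open>The rank bijection turns the sum over partners into one over ranks; only ranks 0
    and 1 survive, available from heights 1 and 2 on respectively.\<close>
  also have "\<dots> = (\<Sum>i<card C. ?F i)"
    by (rule sum.reindex_bij_betw[OF bij_betw_rank[OF Suc.prems(1)]])
  also have "\<dots> = (\<Sum>i\<in>{..<card C} \<inter> {..1}. ?F i)"
    by (rule sum.mono_neutral_right) auto
  also have "{..<card C} \<inter> {..1} = (if card C = 0 then {} else if card C = 1 then {0} else {0, 1})"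
    by auto
  finally show ?case
    by (auto split: if_splits)
qed

end

interpretation less: strict_total_order "(<)"
  by unfold_locales auto

interpretation greater: strict_total_order "(>)"
  by unfold_locales auto

section \<open>Matchings\<close>

lemma arc_diagram_arcs:
  assumes "is_matching m M"
  shows "arc_diagram {1..2 * m} (arcs M)"
proof -
  have P: "partition_on {1..2 * m} M" and two: "\<And>B. B \<in> M \<Longrightarrow> card B = 2"
    using assms by (auto simp: is_matching_def)
  have mem: "fst a < snd a \<and> fst a \<in> {1..2 * m} \<and> snd a \<in> {1..2 * m}" if "a \<in> arcs M" for a
    using that unfolding partition_onD1[OF P] by (auto simp: arcs_def)
  have "\<exists>!a. a \<in> arcs M \<and> (x = fst a \<or> x = snd a)" if x: "x \<in> {1..2 * m}" for x
  proof -
    obtain B where B: "B \<in> M" "x \<in> B" using x unfolding partition_onD1[OF P] by blast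
    obtain i j where "B = {i, j}" "i < j"
      using two[OF B(1)] by (metis card_2_iff doubleton_eq_iff linorder_neqE_nat)
    note ij = this
    have uniq: "B' = B" if "B' \<in> M" "x \<in> B'" for B'
      using partition_onD2[OF P] B that by (auto simp: disjoint_def)
    show ?thesis
    proof (rule ex1I[of _ "(i, j)"])
      show "(i, j) \<in> arcs M \<and> (x = fst (i, j) \<or> x = snd (i, j))"
        using B ij by (auto simp: arcs_def)
      fix a assume a: "a \<in> arcs M \<and> (x = fst a \<or> x = snd a)"
      then have "{fst a, snd a} = {i, j}" "fst a < snd a"
        using uniq[of "{fst a, snd a}"] ij by (auto simp: arcs_def)
      then show "a = (i, j)" using ij by (auto simp: doubleton_eq_iff prod_eq_iff)
    qed
  qed
  then show ?thesis using mem unfolding arc_diagram_def by blast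
qed

text \<open>Forgetting the order within each arc is inverse to \<open>arcs\<close>, since
  \<open>fst a < snd a\<close> restores it.\<close>

lemma bij_betw_arcs: "bij_betw arcs {M. is_matching m M} {A. arc_diagram {1..2 * m} A}"
proof -
  let ?E = "\<lambda>A :: (nat \<times> nat) set. (\<lambda>a. {fst a, snd a}) ` A"
  have E_arcs: "?E (arcs M) = M" if "is_matching m M" for M
  proof (intro equalityI subsetI)
    fix B assume "B \<in> ?E (arcs M)"
    then show "B \<in> M" by (auto simp: arcs_def)
  next
    fix B assume B: "B \<in> M"
    then have "card B = 2" using that by (auto simp: is_matching_def)
    then obtain i j where "B = {i, j}" "i < j"
      by (metis card_2_iff doubleton_eq_iff linorder_neqE_nat)
    then show "B \<in> ?E (arcs M)" using B by (intro image_eqI[of _ _ "(i, j)"]) (auto simp: arcs_def)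
  qed
  have arcs_E: "arcs (?E A) = A" if "arc_diagram X A" for X A
  proof -
    have "a \<in> arcs (?E A) \<longleftrightarrow> a \<in> A" for a
    proof
      assume "a \<in> arcs (?E A)"
      then obtain b where b: "b \<in> A" "fst a < snd a" "{fst a, snd a} = {fst b, snd b}"
        by (auto simp: arcs_def)
      then have "a = b"
        using arc_diagram_memD(1)[OF that b(1)] by (auto simp: doubleton_eq_iff prod_eq_iff)
      then show "a \<in> A" using b(1) by simp
    next
      assume "a \<in> A"
      then show "a \<in> arcs (?E A)"
        using arc_diagram_memD(1)[OF that] by (force simp: arcs_def)
    qed
    then show ?thesis by auto
  qed
  have E_matching: "is_matching m (?E A)" if d: "arc_diagram {1..2 * m} A" for A
    unfolding is_matching_def partition_on_def
  proof (intro conjI)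
    show "\<Union> (?E A) = {1..2 * m}"
    proof (intro equalityI subsetI)
      fix x assume "x \<in> {1..2 * m}"
      then obtain a where "a \<in> A" "x = fst a \<or> x = snd a" using arc_diagram_covers[OF d] by blast
      then show "x \<in> \<Union> (?E A)" by auto
    qed (use arc_diagram_memD[OF d] in auto)
    show "disjoint (?E A)"
      unfolding disjoint_def
    proof (intro ballI impI)
      fix B B' assume "B \<in> ?E A" "B' \<in> ?E A" "B \<noteq> B'"
      then obtain a b where ab: "a \<in> A" "b \<in> A" "B = {fst a, snd a}" "B' = {fst b, snd b}" "a \<noteq> b"
        by blast
      have "False" if "x \<in> B" "x \<in> B'" for x
        using arc_diagram_unique[OF d ab(1,2), of x] that ab by auto
      then show "B \<inter> B' = {}" by blast
    qed
    show "\<forall>B\<in>?E A. card B = 2"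
      using arc_diagram_memD(1)[OF d] by force
  qed auto
  show ?thesis
    by (rule bij_betw_byWitness[where f' = ?E])
      (use E_arcs arcs_E E_matching arc_diagram_arcs in auto)
qed

text \<open>By asymmetry each unordered pair comes from exactly one ordered pair; these are grouped
  by their second component.\<close>

lemma card_unordered_pairs:
  assumes "finite A" and asym: "\<And>a b. P a b \<Longrightarrow> \<not> P b a"
  shows "card {{a, b} | a b. a \<in> A \<and> b \<in> A \<and> P a b} = (\<Sum>b\<in>A. card {a \<in> A. P a b})"
proof -
  let ?S = "SIGMA b:A. {a \<in> A. P a b}"
  have "{{a, b} | a b. a \<in> A \<and> b \<in> A \<and> P a b} = (\<lambda>(b, a). {a, b}) ` ?S"
    by auto
  moreover have "inj_on (\<lambda>(b, a). {a, b}) ?S"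
    using asym by (auto simp: inj_on_def doubleton_eq_iff)
  ultimately have "card {{a, b} | a b. a \<in> A \<and> b \<in> A \<and> P a b} = card ?S"
    by (simp add: card_image)
  also have "\<dots> = (\<Sum>b\<in>A. card {a \<in> A. P a b})"
    using assms(1) by simp
  finally show ?thesis .
qed

lemma num_crossings_eq_sum:
  assumes "is_matching m M"
  shows "num_crossings M = (\<Sum>a\<in>arcs M. left_degree (<) (arcs M) a)"
proof -
  have "finite (arcs M)" using arc_diagram_arcs[OF assms] finite_arc_diagram by blast
  moreover have "crossing b a \<longleftrightarrow> fst b < fst a \<and> fst a < snd b \<and> snd b < snd a" for a b
    by (cases a; cases b) auto
  ultimately show ?thesis
    unfolding num_crossings_def left_degree_def by (subst card_unordered_pairs) auto
qed

text \<open>\<open>nesting b a\<close> demands \<open>fst a < snd a\<close>, which every arc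
  satisfies; the condition \<open>fst a < snd b\<close> of \<open>left_degree\<close> then follows
  from \<open>snd a < snd b\<close>.\<close>

lemma num_nestings_eq_sum:
  assumes "is_matching m M"
  shows "num_nestings M = (\<Sum>a\<in>arcs M. left_degree (>) (arcs M) a)"
proof -
  have "finite (arcs M)" using arc_diagram_arcs[OF assms] finite_arc_diagram by blast
  moreover have "nesting b a \<longleftrightarrow> fst b < fst a \<and> fst a < snd b \<and> snd a < snd b"
    if "a \<in> arcs M" for a b
    using that by (cases a; cases b) (auto simp: arcs_def)
  moreover have "nesting a b \<Longrightarrow> \<not> nesting b a" for a b
    by (cases a; cases b) auto
  ultimately show ?thesis
    unfolding num_nestings_def left_degree_def
    by (subst card_unordered_pairs) (auto intro!: sum.cong arg_cong[where f = card])
qed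

section \<open>Pattern avoidance as a bound on left degrees\<close>

lemma ex_strict_mono_on_6:
  fixes P :: "nat \<Rightarrow> nat \<Rightarrow> nat \<Rightarrow> nat \<Rightarrow> nat \<Rightarrow> nat \<Rightarrow> bool"
  shows "(\<exists>i. strict_mono_on {1..6::nat} i \<and> P (i 1) (i 2) (i 3) (i 4) (i 5) (i 6)) \<longleftrightarrow>
    (\<exists>a b c d e f. a < b \<and> b < c \<and> c < d \<and> d < e \<and> e < f \<and> P a b c d e f)"
proof
  assume "\<exists>i. strict_mono_on {1..6::nat} i \<and> P (i 1) (i 2) (i 3) (i 4) (i 5) (i 6)"
  then obtain i where i: "strict_mono_on {1..6::nat} i" "P (i 1) (i 2) (i 3) (i 4) (i 5) (i 6)"
    by blast
  have "i 1 < i 2" "i 2 < i 3" "i 3 < i 4" "i 4 < i 5" "i 5 < i 6"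
    using i(1) by (auto intro!: strict_mono_onD[OF i(1)])
  then show "\<exists>a b c d e f. a < b \<and> b < c \<and> c < d \<and> d < e \<and> e < f \<and> P a b c d e f"
    using i(2) by blast
next
  assume "\<exists>a b c d e f. a < b \<and> b < c \<and> c < d \<and> d < e \<and> e < f \<and> P a b c d e f"
  then obtain a b c d e f where
    *: "a < b" "b < c" "c < d" "d < e" "e < f" "P a b c d e f" by blast
  \<comment> \<open>Positions in the pattern start at 1, list indices at 0.\<close>
  let ?i = "\<lambda>n. [a, b, c, d, e, f] ! (n - 1)"
  have "{1..6::nat} = {1, 2, 3, 4, 5, 6}" by auto
  then have "strict_mono_on {1..6} ?i"
    using * by (auto simp: strict_mono_on_def)
  then show "\<exists>i. strict_mono_on {1..6::nat} i \<and> P (i 1) (i 2) (i 3) (i 4) (i 5) (i 6)"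
    using *(6) by (intro exI[of _ ?i]) simp
qed

lemma avoids_3:
  "avoids M [p, q, r] \<longleftrightarrow> \<not> (\<exists>i. strict_mono_on {1..6} i \<and>
     (i 1, i (7 - p)) \<in> arcs M \<and> (i 2, i (7 - q)) \<in> arcs M \<and> (i 3, i (7 - r)) \<in> arcs M)"
proof -
  have "{1..3::nat} = {1, 2, 3}" by auto
  then have three: "(\<forall>s\<in>{1..3}. Q s) \<longleftrightarrow> Q 1 \<and> Q 2 \<and> Q 3" for Q :: "nat \<Rightarrow> bool" by simp
  have len: "length [p, q, r] = 3" by simp
  show ?thesis
    unfolding avoids_def Let_def len three by simp
qed

text \<open>Degree at least 2 means that two distinct arcs contribute to a third; distinct arcs have
  distinct openers, so the two can be named with \<open>i < i'\<close>.\<close>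

lemma left_degree_le_1_iff:
  assumes d: "arc_diagram X A" and "finite X"
  shows "(\<forall>a\<in>A. left_degree R A a \<le> 1) \<longleftrightarrow>
    \<not> (\<exists>i i' k j j' l. i < i' \<and> i' < k \<and> k < j \<and> k < j' \<and> R j l \<and> R j' l \<and>
      (i, j) \<in> A \<and> (i', j') \<in> A \<and> (k, l) \<in> A)" (is "_ \<longleftrightarrow> \<not> ?Q")
proof -
  let ?S = "\<lambda>a. {b \<in> A. fst b < fst a \<and> fst a < snd b \<and> R (snd b) (snd a)}"
  have "finite (?S a)" for a using finite_arc_diagram[OF assms] by simp
  then have le1: "left_degree R A a \<le> 1 \<longleftrightarrow> (\<forall>b\<in>?S a. \<forall>b'\<in>?S a. b = b')" for a
    by (simp add: left_degree_def card_le_Suc0_iff_eq)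
  show ?thesis
  proof
    assume deg: "\<forall>a\<in>A. left_degree R A a \<le> 1"
    show "\<not> ?Q"
    proof
      assume ?Q
      then obtain i i' k j j' l where lt: "i < i'" "i' < k" "k < j" "k < j'" "R j l" "R j' l"
        and A: "(i, j) \<in> A" "(i', j') \<in> A" "(k, l) \<in> A" by blast
      have "(i, j) \<in> ?S (k, l)" "(i', j') \<in> ?S (k, l)" using lt A by auto
      then have "(i, j) = (i', j')" using deg A(3) le1[of "(k, l)"] by blast
      then show False using lt(1) by simp
    qed
  next
    assume nQ: "\<not> ?Q"
    show "\<forall>a\<in>A. left_degree R A a \<le> 1"
    proof
      fix a assume a: "a \<in> A"
      have no: "\<not> fst b < fst b'" if "b \<in> ?S a" "b' \<in> ?S a" for b b'
      proof
        assume "fst b < fst b'"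
        moreover have "(fst b, snd b) \<in> A" "(fst b', snd b') \<in> A" "(fst a, snd a) \<in> A"
          using a that by auto
        ultimately show False using nQ that by blast
      qed
      have "b = b'" if "b \<in> ?S a" "b' \<in> ?S a" for b b'
      proof (rule arc_diagram_unique[OF d, of _ _ "fst b"])
        show "fst b = fst b' \<or> fst b = snd b'"
          using no[OF that] no[OF that(2,1)] by linarith
      qed (use that in auto)
      then show "left_degree R A a \<le> 1" unfolding le1 by blast
    qed
  qed
qed

text \<open>
  The two patterns of each pair differ only in the relative order of the closers of the first two
  arcs, so together they forbid two arcs that both contribute to the left degree of the third.
\<close>

lemma avoids_nesting_patterns_iff:
  assumes "is_matching m M"
  shows "avoids M [1, 2, 3] \<and> avoids M [2, 1, 3] \<longleftrightarrow>
    (\<forall>a\<in>arcs M. left_degree (>) (arcs M) a \<le> 1)"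
proof -
  note d = arc_diagram_arcs[OF assms]
  have "(\<not> avoids M [1, 2, 3]) = (\<exists>u v w x y z. u < v \<and> v < w \<and> w < x \<and> x < y \<and> y < z \<and>
      (u, z) \<in> arcs M \<and> (v, y) \<in> arcs M \<and> (w, x) \<in> arcs M)" (is "_ = ?P1")
    unfolding avoids_3 not_not ex_strict_mono_on_6[of "\<lambda>u v w x y z.
      (u, z) \<in> arcs M \<and> (v, y) \<in> arcs M \<and> (w, x) \<in> arcs M", symmetric] by simp
  moreover have "(\<not> avoids M [2, 1, 3]) = (\<exists>u v w x y z. u < v \<and> v < w \<and> w < x \<and> x < y \<and> y < z \<and>
      (u, y) \<in> arcs M \<and> (v, z) \<in> arcs M \<and> (w, x) \<in> arcs M)" (is "_ = ?P2")
    unfolding avoids_3 not_not ex_strict_mono_on_6[of "\<lambda>u v w x y z.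
      (u, y) \<in> arcs M \<and> (v, z) \<in> arcs M \<and> (w, x) \<in> arcs M", symmetric] by simp
  moreover have "?P1 \<or> ?P2 \<longleftrightarrow> (\<exists>i i' k j j' l. i < i' \<and> i' < k \<and> k < j \<and> k < j' \<and> j > l \<and> j' > l \<and>
      (i, j) \<in> arcs M \<and> (i', j') \<in> arcs M \<and> (k, l) \<in> arcs M)" (is "_ \<longleftrightarrow> ?Q")
  proof
    assume "?P1 \<or> ?P2"
    then show ?Q
    proof
      assume ?P1
      then obtain u v w x y z where uz: "u < v" "v < w" "w < x" "x < y" "y < z"
        and A: "(u, z) \<in> arcs M" "(v, y) \<in> arcs M" "(w, x) \<in> arcs M" by blast
      then have "w < z" "w < y" "z > x" "y > x" by auto
      with uz A show ?Q by blast
    next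
      assume ?P2
      then obtain u v w x y z where uz: "u < v" "v < w" "w < x" "x < y" "y < z"
        and A: "(u, y) \<in> arcs M" "(v, z) \<in> arcs M" "(w, x) \<in> arcs M" by blast
      then have "w < y" "w < z" "y > x" "z > x" by auto
      with uz A show ?Q by blast
    qed
  next
    assume ?Q
    then obtain i i' k j j' l where lt: "i < i'" "i' < k" "k < j" "k < j'" "j > l" "j' > l"
      and A: "(i, j) \<in> arcs M" "(i', j') \<in> arcs M" "(k, l) \<in> arcs M" by blast
    have "k < l" using arc_diagram_memD(1)[OF d A(3)] by simp
    have "j \<noteq> j'" using arc_diagram_unique[OF d A(1,2), of j] lt(1) by auto
    \<comment> \<open>The order of the two closers selects the pattern: 123 for
      \<open>j' < j\<close>, 213 for \<open>j < j'\<close>.\<close>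
    then consider "j' < j" | "j < j'" by linarith
    then show "?P1 \<or> ?P2"
    proof cases
      case 1
      then have ?P1 using \<open>k < l\<close> lt A by blast
      then show ?thesis ..
    next
      case 2
      then have ?P2 using \<open>k < l\<close> lt A by blast
      then show ?thesis ..
    qed
  qed
  moreover have "(\<forall>a\<in>arcs M. left_degree (>) (arcs M) a \<le> 1) \<longleftrightarrow> \<not> ?Q"
    by (rule left_degree_le_1_iff[OF d]) simp
  ultimately show ?thesis by argo
qed

lemma avoids_crossing_patterns_iff:
  assumes "is_matching m M"
  shows "avoids M [2, 3, 1] \<and> avoids M [3, 2, 1] \<longleftrightarrow>
    (\<forall>a\<in>arcs M. left_degree (<) (arcs M) a \<le> 1)"
proof -
  note d = arc_diagram_arcs[OF assms]
  have "(\<not> avoids M [2, 3, 1]) = (\<exists>u v w x y z. u < v \<and> v < w \<and> w < x \<and> x < y \<and> y < z \<and>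
      (u, y) \<in> arcs M \<and> (v, x) \<in> arcs M \<and> (w, z) \<in> arcs M)" (is "_ = ?P1")
    unfolding avoids_3 not_not ex_strict_mono_on_6[of "\<lambda>u v w x y z.
      (u, y) \<in> arcs M \<and> (v, x) \<in> arcs M \<and> (w, z) \<in> arcs M", symmetric] by simp
  moreover have "(\<not> avoids M [3, 2, 1]) = (\<exists>u v w x y z. u < v \<and> v < w \<and> w < x \<and> x < y \<and> y < z \<and>
      (u, x) \<in> arcs M \<and> (v, y) \<in> arcs M \<and> (w, z) \<in> arcs M)" (is "_ = ?P2")
    unfolding avoids_3 not_not ex_strict_mono_on_6[of "\<lambda>u v w x y z.
      (u, x) \<in> arcs M \<and> (v, y) \<in> arcs M \<and> (w, z) \<in> arcs M", symmetric] by simp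
  moreover have "?P1 \<or> ?P2 \<longleftrightarrow> (\<exists>i i' k j j' l. i < i' \<and> i' < k \<and> k < j \<and> k < j' \<and> j < l \<and> j' < l \<and>
      (i, j) \<in> arcs M \<and> (i', j') \<in> arcs M \<and> (k, l) \<in> arcs M)" (is "_ \<longleftrightarrow> ?Q")
  proof
    assume "?P1 \<or> ?P2"
    then show ?Q
    proof
      assume ?P1
      then obtain u v w x y z where uz: "u < v" "v < w" "w < x" "x < y" "y < z"
        and A: "(u, y) \<in> arcs M" "(v, x) \<in> arcs M" "(w, z) \<in> arcs M" by blast
      then have "w < y" "w < x" "y < z" "x < z" by auto
      with uz A show ?Q by blast
    next
      assume ?P2
      then obtain u v w x y z where uz: "u < v" "v < w" "w < x" "x < y" "y < z"
        and A: "(u, x) \<in> arcs M" "(v, y) \<in> arcs M" "(w, z) \<in> arcs M" by blast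
      then have "w < x" "w < y" "x < z" "y < z" by auto
      with uz A show ?Q by blast
    qed
  next
    assume ?Q
    then obtain i i' k j j' l where lt: "i < i'" "i' < k" "k < j" "k < j'" "j < l" "j' < l"
      and A: "(i, j) \<in> arcs M" "(i', j') \<in> arcs M" "(k, l) \<in> arcs M" by blast
    have "k < l" using arc_diagram_memD(1)[OF d A(3)] by simp
    have "j \<noteq> j'" using arc_diagram_unique[OF d A(1,2), of j] lt(1) by auto
    \<comment> \<open>Here \<open>j' < j\<close> yields 231 and \<open>j < j'\<close> yields
      321.\<close>
    then consider "j' < j" | "j < j'" by linarith
    then show "?P1 \<or> ?P2"
    proof cases
      case 1
      then have ?P1 using \<open>k < l\<close> lt A by blast
      then show ?thesis ..
    next
      case 2
      then have ?P2 using \<open>k < l\<close> lt A by blast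
      then show ?thesis ..
    qed
  qed
  moreover have "(\<forall>a\<in>arcs M. left_degree (<) (arcs M) a \<le> 1) \<longleftrightarrow> \<not> ?Q"
    by (rule left_degree_le_1_iff[OF d]) simp
  ultimately show ?thesis by argo
qed

section \<open>Transfer of the count to matchings\<close>

lemma card_matchings_eq_card_thin_diagrams:
  assumes "\<And>M. is_matching m M \<Longrightarrow> P M \<longleftrightarrow>
    (\<forall>a\<in>arcs M. left_degree R (arcs M) a \<le> 1) \<and> (\<Sum>a\<in>arcs M. left_degree R (arcs M) a) = k"
  shows "card {M. is_matching m M \<and> P M} = card (thin_diagrams R (2 * m) {} k)"
proof -
  let ?Q = "\<lambda>A. (\<forall>a\<in>A. left_degree R A a \<le> 1) \<and> (\<Sum>a\<in>A. left_degree R A a) = k"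
  have "bij_betw arcs {M \<in> {M. is_matching m M}. P M} {A \<in> {A. arc_diagram {1..2 * m} A}. ?Q A}"
    by (rule bij_betw_Collect[OF bij_betw_arcs]) (use assms in simp)
  \<comment> \<open>With no closers beyond \<open>2 * m\<close>, every opener lies in
    \<open>{1..2 * m}\<close>, which gives the bound on openers in
    \<open>thin_diagrams\<close>.\<close>
  moreover have "{A \<in> {A. arc_diagram {1..2 * m} A}. ?Q A} = thin_diagrams R (2 * m) {} k"
    using arc_diagram_memD(2)[of "{1..2 * m}"] by (fastforce simp: thin_diagrams_def)
  ultimately show ?thesis by (simp add: bij_betw_same_card)
qed

theorem theorem5:
  fixes n k :: nat
  assumes "k \<le> n"
  shows "borel_triangle n k =
           of_nat (card {M. is_matching (n + 1) M \<and> avoids M [1, 2, 3] \<and> avoids M [2, 1, 3] \<and>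
                            num_nestings M = k}) \<and>
         borel_triangle n k =
           of_nat (card {M. is_matching (n + 1) M \<and> avoids M [2, 3, 1] \<and> avoids M [3, 2, 1] \<and>
                            num_crossings M = k})"
proof -
  have "card {M. is_matching (n + 1) M \<and> avoids M [1, 2, 3] \<and> avoids M [2, 1, 3] \<and>
      num_nestings M = k} = marked_paths (2 * (n + 1)) 0 k"
  \<comment> \<open>The order \<open>>\<close> counts nestings; at the right end no closer is
    available yet, so the path starts at height 0.\<close>
  proof (subst card_matchings_eq_card_thin_diagrams[where R = "(>)" and k = k])
    fix M assume M: "is_matching (n + 1) M"
    show "avoids M [1, 2, 3] \<and> avoids M [2, 1, 3] \<and> num_nestings M = k \<longleftrightarrow>
        (\<forall>a\<in>arcs M. left_degree (>) (arcs M) a \<le> 1) \<and>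
        (\<Sum>a\<in>arcs M. left_degree (>) (arcs M) a) = k"
      using avoids_nesting_patterns_iff[OF M] num_nestings_eq_sum[OF M] by metis
  qed (subst greater.card_thin_diagrams, simp_all del: marked_paths.simps)
  moreover have "card {M. is_matching (n + 1) M \<and> avoids M [2, 3, 1] \<and> avoids M [3, 2, 1] \<and>
      num_crossings M = k} = marked_paths (2 * (n + 1)) 0 k"
  proof (subst card_matchings_eq_card_thin_diagrams[where R = "(<)" and k = k])
    fix M assume M: "is_matching (n + 1) M"
    show "avoids M [2, 3, 1] \<and> avoids M [3, 2, 1] \<and> num_crossings M = k \<longleftrightarrow>
        (\<forall>a\<in>arcs M. left_degree (<) (arcs M) a \<le> 1) \<and>
        (\<Sum>a\<in>arcs M. left_degree (<) (arcs M) a) = k"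
      using avoids_crossing_patterns_iff[OF M] num_crossings_eq_sum[OF M] by metis
  qed (subst less.card_thin_diagrams, simp_all del: marked_paths.simps)
  ultimately show ?thesis
    using borel_triangle_eq_marked_paths by simp
qed

end
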